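(* Let $\mathbb{X}=\ell_\infty^n$ (real). If a linear operator $T:\mathbb{X}\to\mathbb{X}$ preserves Birkhoff-James orthogonality at all extreme points of the unit ball $B_{\mathbb{X}}$, then $T$ is a scalar multiple of an isometry.
   Context: $\ell_\infty^n$ is $\mathbb{R}^n$ with the norm $\|x\|=\max_i|x_i|$. For $x,y\in\mathbb{X}$, $x\perp_B y$ (Birkhoff-James orthogonality) means $\|x+\lambda y\|\ge\|x\|$ for all scalars $\lambda$. $T$ preserves Birkhoff-James orthogonality at $x$ if for every $y\in\mathbb{X}$, $x\perp_B y$ implies $Tx\perp_B Ty$. An isometry is a linear operator $S$ with $\|Sx\|=\|x\|$ for all $x$; scalar multiples include the zero multiple. *)

theory Defs
  imports "HOL-Analysis.Analysis"
begin

(* The type real ^ 'n carries the Euclidean norm as its type-class norm. The space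
   l_infinity^n is therefore rendered as real ^ 'n together with the library's infnorm,
   and the notions below take the norm N as an explicit parameter. *)

lemma infnorm_eq_Max_abs: "infnorm (x :: real ^ 'n) = Max (range (\<lambda>i. \<bar>x $ i\<bar>))"
proof -
  have "{\<bar>x $ i\<bar> |i. i \<in> UNIV} = range (\<lambda>i. \<bar>x $ i\<bar>)"
    by auto
  then show ?thesis
    by (simp add: infnorm_cart cSup_eq_Max)
qed

definition unit_ball :: "('a::real_vector \<Rightarrow> real) \<Rightarrow> 'a set"
  where "unit_ball N = {x. N x \<le> 1}"

definition bj_orthogonal :: "('a::real_vector \<Rightarrow> real) \<Rightarrow> 'a \<Rightarrow> 'a \<Rightarrow> bool"
  where "bj_orthogonal N x y \<longleftrightarrow> (\<forall>t::real. N (x + t *\<^sub>R y) \<ge> N x)"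

definition preserves_bj_at :: "('a::real_vector \<Rightarrow> real) \<Rightarrow> ('a \<Rightarrow> 'a) \<Rightarrow> 'a \<Rightarrow> bool"
  where "preserves_bj_at N T x \<longleftrightarrow> (\<forall>y. bj_orthogonal N x y \<longrightarrow> bj_orthogonal N (T x) (T y))"

definition linear_isometry :: "('a::real_vector \<Rightarrow> real) \<Rightarrow> ('a \<Rightarrow> 'a) \<Rightarrow> bool"
  where "linear_isometry N S \<longleftrightarrow> linear S \<and> (\<forall>x. N (S x) = N x)"

end

theory Submission
  imports Defs
begin

text \<open>
  The extreme points of the unit ball that matter are the sign vectors, those with all coordinates
  \<open>1\<close> or \<open>-1\<close>. If a sign vector \<open>x\<close> and an arbitrary vector \<open>z\<close> agree in some coordinate, then
  \<open>x - z\<close> vanishes there and so \<open>x\<close> is orthogonal to \<open>x - z\<close>. Preservation makes \<open>T x\<close> orthogonal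
  to \<open>T x - T z\<close>, and subtracting the latter from the former shows that the norm of \<open>T x\<close> is at
  most that of \<open>T z\<close> (lemma \<open>infnorm_image_sign_vec_le\<close>).

  This single inequality does most of the work. Applied in both directions to two sign vectors it
  shows that \<open>T\<close> takes one constant norm \<open>c\<close> on all of them; antipodal sign vectors, which share
  no coordinate, have images of equal norm anyway. A vector \<open>y\<close> of norm \<open>1\<close> has a coordinate
  \<open>1\<close> or \<open>-1\<close>, hence shares a coordinate with a sign vector, so the norm of \<open>T y\<close> is at
  least \<open>c\<close>. It is at most \<open>c\<close> because a linear map on the cube attains its norm at a vertex
  (lemma \<open>infnorm_linear_le_of_sign_vecs\<close>). Thus \<open>T\<close> multiplies every norm by \<open>c\<close>, and dividing by
  \<open>c\<close>, if it is not zero, leaves an isometry.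
\<close>

definition sign_vec :: "real ^ 'n \<Rightarrow> bool"
  where "sign_vec x \<longleftrightarrow> (\<forall>i. \<bar>x $ i\<bar> = 1)"

lemma infnorm_leI:
  fixes x :: "real ^ 'n"
  assumes "\<And>i. \<bar>x $ i\<bar> \<le> b"
  shows "infnorm x \<le> b"
  using assms by (simp add: infnorm_eq_Max_abs)

lemma infnorm_attained:
  fixes x :: "real ^ 'n"
  obtains k where "\<bar>x $ k\<bar> = infnorm x"
proof -
  have "Max (range (\<lambda>i. \<bar>x $ i\<bar>)) \<in> range (\<lambda>i. \<bar>x $ i\<bar>)"
    by (rule Max_in) auto
  then obtain k where "Max (range (\<lambda>i. \<bar>x $ i\<bar>)) = \<bar>x $ k\<bar>"
    by (rule rangeE)
  then show thesis
    using that[of k] by (simp add: infnorm_eq_Max_abs)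
qed

lemma infnorm_sign_vec:
  fixes x :: "real ^ 'n"
  assumes "sign_vec x"
  shows "infnorm x = 1"
  using assms infnorm_attained[of x] by (metis sign_vec_def)

text \<open>Multiplied by \<open>s\<close>, the combination is an average of \<open>s * a\<close> and \<open>s * b\<close>, at most \<open>1\<close> each, with
  positive weights. Its value is \<open>1\<close>, so both must be \<open>1\<close>.\<close>

lemma interval_endpoint_convex_combination:
  fixes a b u s :: real
  assumes "0 < u" "u < 1" "\<bar>a\<bar> \<le> 1" "\<bar>b\<bar> \<le> 1" "\<bar>s\<bar> = 1" "s = (1 - u) * a + u * b"
  shows "a = b"
proof -
  have ab: "s * a \<le> 1" "s * b \<le> 1"
    using assms(3-5) by (auto simp: abs_if split: if_splits)
  have ss: "s * s = 1"
    using assms by (metis abs_mult_self_eq mult_1)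
  have "(1 - u) * (1 - s * a) + u * (1 - s * b) = 1 - s * ((1 - u) * a + u * b)"
    by (simp add: algebra_simps)
  also have "\<dots> = 0"
    unfolding assms(6)[symmetric] using ss by simp
  finally have "(1 - u) * (1 - s * a) = 0 \<and> u * (1 - s * b) = 0"
    using ab assms by (subst add_nonneg_eq_0_iff[symmetric]) auto
  then have "s * a = s * b"
    using assms by auto
  then show ?thesis
    using assms(5) by auto
qed

lemma sign_vec_extreme_point:
  fixes x :: "real ^ 'n"
  assumes "sign_vec x"
  shows "x extreme_point_of unit_ball infnorm"
  unfolding extreme_point_of_def
proof (intro conjI ballI notI)
  show "x \<in> unit_ball infnorm"
    using assms by (simp add: unit_ball_def infnorm_sign_vec)
next
  fix a b :: "real ^ 'n"
  assume a: "a \<in> unit_ball infnorm" and b: "b \<in> unit_ball infnorm"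
    and "x \<in> open_segment a b"
  then obtain u where "a \<noteq> b" and u: "0 < u" "u < 1" and x: "x = (1 - u) *\<^sub>R a + u *\<^sub>R b"
    by (auto simp: in_segment)
  have "a $ i = b $ i" for i
  proof (rule interval_endpoint_convex_combination[OF u])
    show "\<bar>a $ i\<bar> \<le> 1" "\<bar>b $ i\<bar> \<le> 1"
      using a b component_le_infnorm_cart[of a i] component_le_infnorm_cart[of b i]
      by (auto simp: unit_ball_def)
    show "\<bar>x $ i\<bar> = 1"
      using assms by (simp add: sign_vec_def)
    show "x $ i = (1 - u) * a $ i + u * b $ i"
      using x by simp
  qed
  then show False
    using \<open>a \<noteq> b\<close> by (simp add: vec_eq_iff)
qed

text \<open>Every coordinate of a sign vector attains its norm, so moving in a direction that leaves a
  single coordinate unchanged cannot decrease the norm.\<close>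

lemma sign_vec_bj_orthogonal:
  fixes x y :: "real ^ 'n"
  assumes "sign_vec x" "y $ k = 0"
  shows "bj_orthogonal infnorm x y"
  unfolding bj_orthogonal_def
proof
  fix t :: real
  have "infnorm x = \<bar>(x + t *\<^sub>R y) $ k\<bar>"
    using assms by (simp add: infnorm_sign_vec sign_vec_def)
  also have "\<dots> \<le> infnorm (x + t *\<^sub>R y)"
    by (rule component_le_infnorm_cart)
  finally show "infnorm x \<le> infnorm (x + t *\<^sub>R y)" .
qed

lemma infnorm_image_sign_vec_le:
  fixes T :: "real ^ 'n \<Rightarrow> real ^ 'n"
  assumes "linear T" "preserves_bj_at infnorm T x" "sign_vec x" "z $ k = x $ k"
  shows "infnorm (T x) \<le> infnorm (T z)"
proof -
  have "bj_orthogonal infnorm x (x - z)"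
    using assms by (intro sign_vec_bj_orthogonal[of _ _ k]) auto
  then have "bj_orthogonal infnorm (T x) (T x - T z)"
    using assms by (simp add: preserves_bj_at_def flip: linear_diff[OF assms(1)])
  then have "infnorm (T x) \<le> infnorm (T x + (-1) *\<^sub>R (T x - T z))"
    unfolding bj_orthogonal_def by blast
  then show ?thesis
    by simp
qed

text \<open>Each coordinate of \<open>T\<close> is a linear functional, and its value at the sign vector formed by the
  signs of its coefficients is the sum of their absolute values, its norm as a functional on the
  cube.\<close>

lemma infnorm_linear_le_of_sign_vecs:
  fixes T :: "real ^ 'n \<Rightarrow> real ^ 'm"
  assumes lin: "linear T" and bound: "\<And>x. sign_vec x \<Longrightarrow> infnorm (T x) \<le> c"
  shows "infnorm (T y) \<le> c * infnorm y"
proof (rule infnorm_leI)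
  fix i
  define a where "a j = T (axis j 1) $ i" for j
  have expand: "T z $ i = (\<Sum>j\<in>UNIV. z $ j * a j)" for z
  proof -
    have "T z = T (\<Sum>j\<in>UNIV. z $ j *\<^sub>R axis j 1)"
      using basis_expansion[of z] by (simp add: scalar_mult_eq_scaleR)
    also have "\<dots> = (\<Sum>j\<in>UNIV. z $ j *\<^sub>R T (axis j 1))"
      by (simp add: linear_sum[OF lin] linear_scale[OF lin])
    finally show ?thesis
      by (simp add: a_def)
  qed
  \<comment> \<open>The library function \<open>sgn\<close> would give 0, not a sign, at a vanishing coefficient.\<close>
  define x :: "real ^ 'n" where "x = (\<chi> j. if a j \<ge> 0 then 1 else -1)"
  have "sign_vec x"
    by (simp add: sign_vec_def x_def)
  have "(\<Sum>j\<in>UNIV. \<bar>a j\<bar>) = T x $ i"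
    unfolding expand by (intro sum.cong) (auto simp: x_def)
  also have "\<dots> \<le> infnorm (T x)"
    using component_le_infnorm_cart[of "T x" i] by linarith
  also have "\<dots> \<le> c"
    using \<open>sign_vec x\<close> by (rule bound)
  finally have sum_le: "(\<Sum>j\<in>UNIV. \<bar>a j\<bar>) \<le> c" .
  have "\<bar>T y $ i\<bar> \<le> (\<Sum>j\<in>UNIV. \<bar>y $ j * a j\<bar>)"
    unfolding expand by (rule sum_abs)
  also have "\<dots> \<le> (\<Sum>j\<in>UNIV. infnorm y * \<bar>a j\<bar>)"
    by (intro sum_mono) (simp add: abs_mult mult_right_mono component_le_infnorm_cart)
  also have "\<dots> = (\<Sum>j\<in>UNIV. \<bar>a j\<bar>) * infnorm y"
    by (simp add: sum_distrib_left mult.commute)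
  also have "\<dots> \<le> c * infnorm y"
    using sum_le by (intro mult_right_mono infnorm_pos_le)
  finally show "\<bar>T y $ i\<bar> \<le> c * infnorm y" .
qed

lemma scalar_multiple_of_isometry:
  fixes T :: "'a::euclidean_space \<Rightarrow> 'a"
  assumes lin: "linear T" and scale: "\<And>y. infnorm (T y) = c * infnorm y" and "c \<ge> 0"
  shows "\<exists>c S. linear_isometry infnorm S \<and> T = (\<lambda>x. c *\<^sub>R S x)"
proof (cases "c = 0")
  case True
  then have "T = (\<lambda>x. 0 *\<^sub>R id x)"
    using scale by (auto simp: infnorm_eq_0)
  moreover have "linear_isometry infnorm (id :: 'a \<Rightarrow> 'a)"
    by (simp add: linear_isometry_def linear_id)
  ultimately show ?thesis
    by blast
next
  case False
  define S where "S y = (1 / c) *\<^sub>R T y" for y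
  have "linear S"
    unfolding S_def by (intro linear_compose_scale_right lin)
  moreover have "infnorm (S y) = infnorm y" for y
    using False \<open>c \<ge> 0\<close> by (simp add: S_def infnorm_mul scale)
  moreover have "T = (\<lambda>x. c *\<^sub>R S x)"
    using False by (simp add: S_def)
  ultimately show ?thesis
    unfolding linear_isometry_def by blast
qed

theorem theorem2p19:
  fixes T :: "real ^ 'n \<Rightarrow> real ^ 'n"
  assumes "linear T"
    and "\<And>x. x extreme_point_of unit_ball infnorm \<Longrightarrow> preserves_bj_at infnorm T x"
  shows "\<exists>(c::real) S. linear_isometry infnorm S \<and> T = (\<lambda>x. c *\<^sub>R S x)"
proof -
  have le: "infnorm (T x) \<le> infnorm (T z)" if "sign_vec x" "z $ k = x $ k" for x z k
    using infnorm_image_sign_vec_le[OF assms(1)] assms(2) sign_vec_extreme_point that by blast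
  define e :: "real ^ 'n" where "e = (\<chi> i. 1)"
  define c where "c = infnorm (T e)"
  have e: "sign_vec e"
    by (simp add: sign_vec_def e_def)
  have const: "infnorm (T x) = c" if x: "sign_vec x" for x
  proof (cases "\<exists>k. x $ k = e $ k")
    case True
    then show ?thesis
      unfolding c_def using le x e by (metis order_antisym)
  next
    case False
    \<comment> \<open>Two sign vectors without a common coordinate are antipodal.\<close>
    have "x $ i = - (e $ i)" for i
    proof -
      have "\<bar>x $ i\<bar> = 1" "x $ i \<noteq> 1"
        using x False by (auto simp: sign_vec_def e_def)
      then show ?thesis
        by (auto simp: e_def)
    qed
    then have "x = - e"
      by (simp add: vec_eq_iff)
    then show ?thesis
      by (simp add: c_def linear_neg[OF assms(1)] infnorm_neg)
  qed
  have upper: "infnorm (T y) \<le> c * infnorm y" for y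
    by (intro infnorm_linear_le_of_sign_vecs assms(1)) (simp add: const)
  have lower: "c * infnorm y \<le> infnorm (T y)" for y
  proof (cases "y = 0")
    case True
    then show ?thesis
      by (simp add: infnorm_0 infnorm_pos_le)
  next
    case False
    then have m: "infnorm y > 0"
      by (simp add: infnorm_pos_lt)
    obtain k where k: "\<bar>y $ k\<bar> = infnorm y"
      by (rule infnorm_attained)
    define z where "z = (1 / infnorm y) *\<^sub>R y"
    have zk: "\<bar>z $ k\<bar> = 1"
      using k m by (simp add: z_def)
    define x :: "real ^ 'n" where "x = (\<chi> i. z $ k)"
    have x: "sign_vec x" "z $ k = x $ k"
      using zk by (simp_all add: sign_vec_def x_def)
    then have "c \<le> infnorm (T z)"
      using le const by metis
    also have "\<dots> = infnorm (T y) / infnorm y"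
      using m by (simp add: z_def linear_scale[OF assms(1)] infnorm_mul)
    finally show ?thesis
      using m by (simp add: field_simps)
  qed
  show ?thesis
    using assms(1)
  proof (rule scalar_multiple_of_isometry)
    show "infnorm (T y) = c * infnorm y" for y
      using upper lower by (rule order_antisym)
    show "c \<ge> 0"
      by (simp add: c_def infnorm_pos_le)
  qed
qed

end
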